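(* Let $G$ be a topological group and $\mathcal{Y}$ a Hausdorff locally convex space. Let $X,X_1,X_2\in\mathfrak{L}(G)$ be such that $$X(t)=\lim_{n\to\infty}\Big(X_1\big(\tfrac{t}{n}\big)X_2\big(\tfrac{t}{n}\big)\Big)^n$$ for all $t\in\mathbb{R}$, with convergence uniform on every compact subset of $\mathbb{R}$. Then $D^\lambda_X\phi=D^\lambda_{X_1}\phi+D^\lambda_{X_2}\phi$ for every $\phi\in\mathcal{LUC}^1_{\rm loc}(G,\mathcal{Y})$.
   Context: All topological groups are Hausdorff. $\mathfrak{L}(G)$ is the set of continuous homomorphisms $(\mathbb{R},+)\to G$. For $\phi\colon G\to\mathcal{Y}$, $X\in\mathfrak{L}(G)$, $g\in G$: $(D^\lambda_X\phi)(g)=\lim_{t\to0}\frac{\phi(gX(t))-\phi(g)}{t}$ when it exists. $\mathcal{LUC}_{\rm loc}(G,\mathcal{Y})$ is the set of $\phi\colon G\to\mathcal{Y}$ such that every $g_0\in G$ has a neighborhood $V$ with the property: for every neighborhood $U$ of $0\in\mathcal{Y}$ there is a neighborhood $W$ of $\mathbf{1}\in G$ such that $x,y\in V$, $x^{-1}y\in W$ imply $\phi(x)-\phi(y)\in U$. $\mathcal{LUC}^1_{\rm loc}(G,\mathcal{Y})$ is the set of $\phi\in\mathcal{LUC}_{\rm loc}(G,\mathcal{Y})$ such that $D^\lambda_X\phi(g)$ exists for all $X,g$ and $D^\lambda_X\phi\in\mathcal{LUC}_{\rm loc}(G,\mathcal{Y})$ for every $X\in\mathfrak{L}(G)$. 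*)

theory Defs
  imports "HOL-Analysis.Analysis"
begin

text \<open>Topological groups are written additively (type class group_add, which is
  NOT assumed commutative). The group product x y is x + y, the inverse is -x,
  the identity is 0. Hausdorffness comes from the class t2_space.\<close>

definition topological_group :: "'g::{t2_space,group_add} itself \<Rightarrow> bool" where
  "topological_group _ \<longleftrightarrow>
     continuous_on UNIV (\<lambda>p::'g \<times> 'g. fst p + snd p) \<and>
     continuous_on UNIV (uminus :: 'g \<Rightarrow> 'g)"

text \<open>Hausdorff locally convex (real) topological vector space.\<close>
definition locally_convex_space :: "'y::{t2_space,real_vector} itself \<Rightarrow> bool" where
  "locally_convex_space _ \<longleftrightarrow>
     continuous_on UNIV (\<lambda>p::'y \<times> 'y. fst p + snd p) \<and>
     continuous_on UNIV (\<lambda>p::real \<times> 'y. fst p *\<^sub>R snd p) \<and>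
     (\<forall>U::'y set. open U \<and> 0 \<in> U \<longrightarrow> (\<exists>C. convex C \<and> open C \<and> 0 \<in> C \<and> C \<subseteq> U))"

text \<open>One-parameter subgroups: continuous homomorphisms (R,+) -> G.\<close>
definition one_param_subgroups :: "(real \<Rightarrow> 'g::{topological_space,group_add}) set" where
  "one_param_subgroups = {X. continuous_on UNIV X \<and> (\<forall>s t. X (s + t) = X s + X t)}"

text \<open>n-th power of a group element (additive notation: a + a + ... + a).\<close>
fun gpow :: "nat \<Rightarrow> 'g::group_add \<Rightarrow> 'g" where
  "gpow 0 a = 0"
| "gpow (Suc n) a = a + gpow n a"

text \<open>Left derivative along X at g: lim_{t->0} (phi(g X(t)) - phi(g))/t.\<close>
definition has_left_deriv ::
  "('g::{topological_space,group_add} \<Rightarrow> 'y::{t2_space,real_vector}) \<Rightarrow> (real \<Rightarrow> 'g) \<Rightarrow> 'g \<Rightarrow> 'y \<Rightarrow> bool" where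
  "has_left_deriv \<phi> X g d \<longleftrightarrow>
     ((\<lambda>t. (1 / t) *\<^sub>R (\<phi> (g + X t) - \<phi> g)) \<longlongrightarrow> d) (at 0)"

definition left_deriv ::
  "('g::{topological_space,group_add} \<Rightarrow> 'y::{t2_space,real_vector}) \<Rightarrow> (real \<Rightarrow> 'g) \<Rightarrow> 'g \<Rightarrow> 'y" where
  "left_deriv \<phi> X g = Lim (at 0) (\<lambda>t. (1 / t) *\<^sub>R (\<phi> (g + X t) - \<phi> g))"

definition LUC_loc :: "('g::{topological_space,group_add} \<Rightarrow> 'y::{topological_space,real_vector}) set" where
  "LUC_loc = {\<phi>. \<forall>g0. \<exists>V. open V \<and> g0 \<in> V \<and>
      (\<forall>U. open U \<and> 0 \<in> U \<longrightarrow>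
        (\<exists>W. open W \<and> 0 \<in> W \<and>
          (\<forall>x\<in>V. \<forall>y\<in>V. - x + y \<in> W \<longrightarrow> \<phi> x - \<phi> y \<in> U)))}"

definition LUC1_loc :: "('g::{topological_space,group_add} \<Rightarrow> 'y::{t2_space,real_vector}) set" where
  "LUC1_loc = {\<phi>. \<phi> \<in> LUC_loc \<and>
      (\<forall>X\<in>one_param_subgroups. \<forall>g. \<exists>d. has_left_deriv \<phi> X g d) \<and>
      (\<forall>X\<in>one_param_subgroups. left_deriv \<phi> X \<in> LUC_loc)}"

end

theory Submission
  imports Defs
begin

(* Fix phi and g, and let d and D be the derivatives of phi at g along X and along X1 plus X2.
   Since the target space carries no norm, all estimates are membership in multiples t C of a
   convex open neighbourhood C of 0.  A mean value inequality (proved by real induction) and the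
   continuity of the derivatives give phi(p X_i(s)) - phi(p) - s D_i(g) in s C uniformly for p
   near g and small s > 0.  For small t and large n all partial products (X1(t/n) X2(t/n))^k,
   k < n, stay near the identity, so telescoping along them bounds
   phi(g (X1(t/n) X2(t/n))^n) - phi(g) - t D by 2 t C; this point is close to g X(t), and
   phi(g X(t)) - phi(g) - t d lies in t C.  Hence d - D lies in 4 C for every symmetric such C,
   and d = D because the space is Hausdorff and locally convex. *)

lemma scaled_convex_add:
  fixes C :: "'y::real_vector set"
  assumes "convex C" "0 \<in> C" "0 \<le> a" "0 \<le> b" "x \<in> (*\<^sub>R) a ` C" "y \<in> (*\<^sub>R) b ` C"
  shows "x + y \<in> (*\<^sub>R) (a + b) ` C"
proof -
  obtain c1 c2 where c: "c1 \<in> C" "c2 \<in> C" "x = a *\<^sub>R c1" "y = b *\<^sub>R c2"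
    using assms by auto
  show ?thesis
  proof (cases "a + b = 0")
    case True
    then have "a = 0" "b = 0" using assms by auto
    then show ?thesis using c assms by (auto intro!: image_eqI[of _ _ 0])
  next
    case False
    then have pos: "a + b > 0" using assms by auto
    let ?c = "(a / (a + b)) *\<^sub>R c1 + (b / (a + b)) *\<^sub>R c2"
    have "?c \<in> C" using assms(1,3,4) c(1,2) pos
      by (intro convexD) (auto simp: add_divide_distrib[symmetric])
    moreover have "x + y = (a + b) *\<^sub>R ?c" using pos c by (simp add: scaleR_add_right)
    ultimately show ?thesis by auto
  qed
qed

lemma scaled_convex_sum:
  fixes C :: "'y::real_vector set"
  assumes "convex C" "0 \<in> C" "0 \<le> a" "\<And>k. k < n \<Longrightarrow> x k \<in> (*\<^sub>R) a ` C"
  shows "(\<Sum>k<n. x k) \<in> (*\<^sub>R) (real n * a) ` C"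
  using assms(4)
proof (induction n)
  case 0
  then show ?case using assms(2) by (auto intro!: image_eqI[of _ _ 0])
next
  case (Suc n)
  have "(\<Sum>k<n. x k) + x n \<in> (*\<^sub>R) (real n * a + a) ` C"
    using Suc assms by (intro scaled_convex_add) auto
  then show ?case by (simp add: algebra_simps)
qed

lemma scaled_convex_telescope:
  fixes C :: "'y::real_vector set"
  assumes "convex C" "0 \<in> C" "0 \<le> a" "\<And>k. k < n \<Longrightarrow> f (Suc k) - f k - w \<in> (*\<^sub>R) a ` C"
  shows "f n - f 0 - real n *\<^sub>R w \<in> (*\<^sub>R) (real n * a) ` C"
proof -
  have "(\<Sum>k<n. f (Suc k) - f k - w) = (\<Sum>k<n. f (Suc k) - f k) - (\<Sum>k<n. w)"
    by (rule sum_subtractf)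
  also have "\<dots> = f n - f 0 - real n *\<^sub>R w"
    by (simp add: sum_lessThan_telescope sum_constant_scaleR)
  finally show ?thesis
    using scaled_convex_sum[of C a n "\<lambda>k. f (Suc k) - f k - w"] assms by simp
qed

lemma scaled_symmetric_uminus:
  fixes C :: "'y::real_vector set"
  assumes "\<And>c. c \<in> C \<Longrightarrow> - c \<in> C" "x \<in> (*\<^sub>R) a ` C"
  shows "- x \<in> (*\<^sub>R) a ` C"
proof -
  obtain c where "c \<in> C" "x = a *\<^sub>R c" using assms(2) by blast
  then have "- c \<in> C" "- x = a *\<^sub>R (- c)" using assms(1) by auto
  then show ?thesis by blast
qed

lemma real_interval_induct:
  fixes s :: real
  assumes "0 \<le> s" "P 0"
    and step: "\<And>r. 0 \<le> r \<Longrightarrow> r < s \<Longrightarrow> P r \<Longrightarrow> \<exists>d>0. \<forall>h. 0 < h \<and> h < d \<longrightarrow> P (r + h)"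
    and limit: "\<And>r. 0 < r \<Longrightarrow> r \<le> s \<Longrightarrow> (\<And>q. 0 \<le> q \<Longrightarrow> q < r \<Longrightarrow> P q) \<Longrightarrow> P r"
  shows "P s"
proof -
  define T where "T = {r. r \<le> s \<and> (\<forall>q. 0 \<le> q \<and> q \<le> r \<longrightarrow> P q)}"
  define m where "m = Sup T"
  have T0: "0 \<in> T" using assms(1,2) by (auto simp: T_def)
  have bdd: "bdd_above T" by (auto simp: T_def intro: bdd_aboveI[of _ s])
  have m0: "0 \<le> m" unfolding m_def using T0 bdd by (rule cSup_upper)
  have ms: "m \<le> s" unfolding m_def using T0 by (intro cSup_least) (auto simp: T_def)
  have below: "P q" if "0 \<le> q" "q < m" for q
  proof -
    have "q < Sup T" using that by (simp add: m_def)
    then obtain r where "r \<in> T" "q < r" using less_cSup_iff[OF _ bdd] T0 by blast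
    then show ?thesis using that by (auto simp: T_def)
  qed
  have Pm: "P m"
    using m0 ms below limit assms(2) by (cases "m = 0") auto
  have "m = s"
  proof (rule ccontr)
    assume "m \<noteq> s"
    with ms obtain d where d: "d > 0" "\<forall>h. 0 < h \<and> h < d \<longrightarrow> P (m + h)"
      using step[OF m0 _ Pm] by fastforce
    define r where "r = min (m + d / 2) s"
    have "P q" if "0 \<le> q" "q \<le> r" for q
    proof (cases "q \<le> m")
      case True
      then show ?thesis using below Pm that(1) by (cases "q = m") auto
    next
      case False
      then have "P (m + (q - m))" using d that by (intro d(2)[rule_format]) (auto simp: r_def)
      then show ?thesis by simp
    qed
    then have "r \<in> T" by (auto simp: T_def r_def)
    then have "r \<le> m" unfolding m_def using bdd by (rule cSup_upper)
    then show False using d(1) ms \<open>m \<noteq> s\<close> by (simp add: r_def)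
  qed
  with Pm show ?thesis by simp
qed

lemma mean_value_convex:
  fixes f :: "real \<Rightarrow> 'y::real_vector"
  assumes C: "convex C" "0 \<in> C" and "0 \<le> s"
    and quotient: "\<And>r. 0 \<le> r \<Longrightarrow> r \<le> s \<Longrightarrow> \<forall>\<^sub>F h in at 0. (1 / h) *\<^sub>R (f (r + h) - f r) \<in> C"
  shows "f s - f 0 \<in> (*\<^sub>R) s ` C"
proof (rule real_interval_induct[where P = "\<lambda>q. f q - f 0 \<in> (*\<^sub>R) q ` C"])
  have extend: "f (q + h) - f 0 \<in> (*\<^sub>R) (q + h) ` C"
    if "0 \<le> q" "0 < h" "f q - f 0 \<in> (*\<^sub>R) q ` C" "(1 / h) *\<^sub>R (f (q + h) - f q) \<in> C" for q h
  proof -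
    have "f (q + h) - f q \<in> (*\<^sub>R) h ` C"
      using that by (intro image_eqI[of _ _ "(1 / h) *\<^sub>R (f (q + h) - f q)"]) auto
    from scaled_convex_add[OF C _ _ that(3) this] that(1,2) show ?thesis
      by (simp add: add.commute)
  qed
  show "\<exists>d>0. \<forall>h. 0 < h \<and> h < d \<longrightarrow> f (r + h) - f 0 \<in> (*\<^sub>R) (r + h) ` C"
    if r: "0 \<le> r" "r < s" "f r - f 0 \<in> (*\<^sub>R) r ` C" for r
  proof -
    obtain d where "d > 0" "\<And>h. h \<noteq> 0 \<Longrightarrow> \<bar>h\<bar> < d \<Longrightarrow> (1 / h) *\<^sub>R (f (r + h) - f r) \<in> C"
      using quotient[of r] r(1,2) unfolding eventually_at by (auto simp: dist_real_def)
    then show ?thesis using extend[OF r(1) _ r(3)] by (intro exI[of _ d]) auto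
  qed
  show "f r - f 0 \<in> (*\<^sub>R) r ` C"
    if r: "0 < r" "r \<le> s" and below: "\<And>q. 0 \<le> q \<Longrightarrow> q < r \<Longrightarrow> f q - f 0 \<in> (*\<^sub>R) q ` C"
    for r
  proof -
    obtain d where d: "d > 0" "\<And>h. h \<noteq> 0 \<Longrightarrow> \<bar>h\<bar> < d \<Longrightarrow> (1 / h) *\<^sub>R (f (r + h) - f r) \<in> C"
      using quotient[of r] r unfolding eventually_at by (auto simp: dist_real_def)
    define h where "h = min (d / 2) r"
    have h: "0 < h" "h \<le> r" "h < d" using d r by (auto simp: h_def)
    \<comment> \<open>the difference quotient at \<open>r\<close> with step \<open>-h\<close> is the forward quotient at \<open>r - h\<close>\<close>
    have "(1 / h) *\<^sub>R (f ((r - h) + h) - f (r - h)) = (1 / - h) *\<^sub>R (f (r + - h) - f r)"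
      by (simp add: algebra_simps)
    then have "(1 / h) *\<^sub>R (f ((r - h) + h) - f (r - h)) \<in> C" using d(2)[of "- h"] h by simp
    with extend[of "r - h" h] below[of "r - h"] h show ?thesis by simp
  qed
qed (use assms in auto)

lemma open_vimage_continuous_UNIV:
  "continuous_on UNIV f \<Longrightarrow> open S \<Longrightarrow> open {x. f x \<in> S}"
  using open_vimage[of S f] by (simp add: vimage_def)

lemma topological_group_continuous_on_add:
  assumes "topological_group TYPE('g::{t2_space,group_add})"
    and "continuous_on UNIV (f :: 'a::topological_space \<Rightarrow> 'g)" "continuous_on UNIV g"
  shows "continuous_on UNIV (\<lambda>x. f x + g x)"
proof -
  have "continuous_on UNIV (\<lambda>x. (f x, g x))" using assms by (intro continuous_on_Pair)
  from continuous_on_compose2[OF _ this, of UNIV "\<lambda>p. fst p + snd p"] assms(1)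
  show ?thesis by (auto simp: topological_group_def)
qed

lemma topological_group_open_left_translate:
  assumes "topological_group TYPE('g::{t2_space,group_add})" "open S"
  shows "open {y::'g. a + y \<in> S}"
  using assms by (intro open_vimage_continuous_UNIV topological_group_continuous_on_add)
    (auto intro: continuous_on_id)

lemma topological_group_open_sum_nhds:
  assumes "topological_group TYPE('g::{t2_space,group_add})" "open S" "a + b \<in> S"
  obtains A B where "open A" "open B" "a \<in> A" "(b::'g) \<in> B" "\<And>x y. x \<in> A \<Longrightarrow> y \<in> B \<Longrightarrow> x + y \<in> S"
proof -
  have "open {p::'g \<times> 'g. fst p + snd p \<in> S}"
    using assms(1,2) by (intro open_vimage_continuous_UNIV) (auto simp: topological_group_def)
  from open_prod_elim[OF this, of "(a, b)"] assms(3)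
  obtain A B where "open A" "open B" "(a, b) \<in> A \<times> B" "A \<times> B \<subseteq> {p. fst p + snd p \<in> S}"
    by auto
  then show ?thesis by (intro that[of A B]) auto
qed

lemma tendsto_group_left_difference:
  assumes "topological_group TYPE('g::{t2_space,group_add})"
    and "\<And>U. open U \<Longrightarrow> 0 \<in> U \<Longrightarrow> \<forall>\<^sub>F x in F. - a + f x \<in> U"
  shows "(f \<longlongrightarrow> (a::'g)) F"
proof (rule topological_tendstoI)
  fix S assume "open S" "a \<in> S"
  then have "\<forall>\<^sub>F x in F. - a + f x \<in> {u. a + u \<in> S}"
    using assms by (intro assms(2) topological_group_open_left_translate) auto
  then show "\<forall>\<^sub>F x in F. f x \<in> S"
    by (rule eventually_mono) (simp add: add.assoc[symmetric])
qed

lemma gpow_Suc_right: "gpow (Suc k) a = gpow k a + (a::'g::group_add)"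
  by (induction k) (simp_all, metis add.assoc)

lemma gpow_zero_right: "gpow k (0::'g::group_add) = 0"
  by (induction k) auto

lemma continuous_on_gpow:
  assumes "topological_group TYPE('g::{t2_space,group_add})"
  shows "continuous_on UNIV (gpow k :: 'g \<Rightarrow> 'g)"
proof (induction k)
  case (Suc k)
  then have "continuous_on UNIV (\<lambda>a::'g. a + gpow k a)"
    by (intro topological_group_continuous_on_add[OF assms] continuous_on_id)
  then show ?case by simp
qed simp

lemma one_param_subgroup_add:
  "X \<in> one_param_subgroups \<Longrightarrow> X (s + t) = X s + X t"
  by (simp add: one_param_subgroups_def)

lemma one_param_subgroup_continuous:
  "X \<in> one_param_subgroups \<Longrightarrow> continuous_on UNIV X"
  by (simp add: one_param_subgroups_def)

lemma one_param_subgroup_zero: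
  assumes "X \<in> one_param_subgroups"
  shows "X 0 = (0::'g::{topological_space,group_add})"
proof -
  have "X 0 + 0 = X 0 + X 0" using one_param_subgroup_add[OF assms, of 0 0] by simp
  then show ?thesis using add_left_cancel by metis
qed

lemma one_param_subgroup_tendsto_zero:
  assumes "X \<in> one_param_subgroups"
  shows "(X \<longlongrightarrow> (0::'g::{topological_space,group_add})) (nhds 0)"
  using one_param_subgroup_continuous[OF assms] one_param_subgroup_zero[OF assms]
  by (metis continuous_on_def UNIV_I tendsto_at_iff_tendsto_nhds)

lemma one_param_subgroup_small:
  assumes "X \<in> one_param_subgroups" "open W" "(0::'g::{topological_space,group_add}) \<in> W"
  obtains d where "d > 0" "\<And>r. \<bar>r\<bar> < d \<Longrightarrow> X r \<in> W"
proof -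
  have "\<forall>\<^sub>F r in nhds 0. X r \<in> W"
    using one_param_subgroup_tendsto_zero[OF assms(1)] assms(2,3) by (rule topological_tendstoD)
  then show ?thesis using that unfolding eventually_nhds_metric by (auto simp: dist_real_def)
qed

lemma locally_convex_open_affine_vimage:
  assumes "locally_convex_space TYPE('y::{t2_space,real_vector})" "open S"
  shows "open {x::'y. c + a *\<^sub>R x \<in> S}"
proof -
  have add: "continuous_on UNIV (\<lambda>p::'y \<times> 'y. fst p + snd p)"
    and mult: "continuous_on UNIV (\<lambda>p::real \<times> 'y. fst p *\<^sub>R snd p)"
    using assms(1) unfolding locally_convex_space_def by auto
  have "continuous_on UNIV (\<lambda>x::'y. a *\<^sub>R x)"
    using continuous_on_compose2[OF mult continuous_on_Pair[OF continuous_on_const continuous_on_id]]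
    by auto
  then have "continuous_on UNIV (\<lambda>x::'y. c + a *\<^sub>R x)"
    using continuous_on_compose2[OF add continuous_on_Pair[OF continuous_on_const]] by auto
  then show ?thesis using assms(2) by (rule open_vimage_continuous_UNIV)
qed

lemma locally_convex_open_diff_vimage:
  assumes "locally_convex_space TYPE('y::{t2_space,real_vector})" "open S"
  shows "open {x::'y. x - c \<in> S}"
  using locally_convex_open_affine_vimage[OF assms, of "- c" 1] by simp

lemma locally_convex_open_scaled:
  assumes "locally_convex_space TYPE('y::{t2_space,real_vector})" "open (S::'y set)" "a \<noteq> 0"
  shows "open ((*\<^sub>R) a ` S)"
proof -
  have "(*\<^sub>R) a ` S = {x. 0 + (1 / a) *\<^sub>R x \<in> S}"
    using assms(3) by (auto intro!: image_eqI[of _ _ "(1 / a) *\<^sub>R _"])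
  then show ?thesis using locally_convex_open_affine_vimage[OF assms(1,2), of 0 "1 / a"] by simp
qed

lemma tendsto_eventually_diff_mem:
  assumes "locally_convex_space TYPE('y::{t2_space,real_vector})"
    and "(f \<longlongrightarrow> c) F" "open S" "c - b \<in> S"
  shows "\<forall>\<^sub>F x in F. f x - b \<in> (S::'y set)"
  using topological_tendstoD[OF assms(2) locally_convex_open_diff_vimage[OF assms(1,3)]] assms(4)
  by simp

lemma locally_convex_symmetric_nhd_avoiding:
  assumes "locally_convex_space TYPE('y::{t2_space,real_vector})" "(v::'y) \<noteq> 0" "a > 0"
  obtains C where "convex C" "open C" "0 \<in> C" "\<And>c. c \<in> C \<Longrightarrow> - c \<in> C" "v \<notin> (*\<^sub>R) a ` C"
proof -
  obtain U where "open U" "0 \<in> U" "v \<notin> U"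
    using hausdorff[OF assms(2)] by blast
  then obtain C0 where C0: "convex C0" "open C0" "0 \<in> C0" "C0 \<subseteq> U" "v \<notin> C0"
    using assms(1) unfolding locally_convex_space_def by blast
  define C where "C = (*\<^sub>R) (1 / a) ` (C0 \<inter> (*\<^sub>R) (- 1) ` C0)"
  show ?thesis
  proof (rule that)
    show "convex C" unfolding C_def using C0(1) by (intro convex_scaling convex_Int)
    show "open C" unfolding C_def using assms(1,3) C0(2)
      by (intro locally_convex_open_scaled open_Int) auto
    show "0 \<in> C" unfolding C_def using C0(3) by (auto intro!: image_eqI[of _ _ 0])
    show "- c \<in> C" if "c \<in> C" for c
    proof -
      obtain c0 where "c0 \<in> C0" "- c0 \<in> C0" "c = (1 / a) *\<^sub>R c0"
        using \<open>c \<in> C\<close> unfolding C_def by (auto simp: image_iff)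
      then have "- c0 \<in> C0 \<inter> (*\<^sub>R) (- 1) ` C0" "- c = (1 / a) *\<^sub>R (- c0)"
        by (auto intro!: image_eqI[of _ _ c0])
      then show ?thesis unfolding C_def by blast
    qed
    have "(*\<^sub>R) a ` C \<subseteq> C0"
      unfolding C_def using assms(3) by (auto simp: image_image)
    then show "v \<notin> (*\<^sub>R) a ` C" using C0(5) by blast
  qed
qed

lemma LUC_loc_continuous:
  fixes \<phi> :: "'g::{t2_space,group_add} \<Rightarrow> 'y::{t2_space,real_vector}"
  assumes tg: "topological_group TYPE('g)" and lc: "locally_convex_space TYPE('y)"
    and "\<phi> \<in> LUC_loc"
  shows "continuous_on UNIV \<phi>"
  unfolding continuous_on_open_vimage[OF open_UNIV]
proof (intro allI impI Topological_Spaces.openI)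
  fix S z assume S: "open S" and z: "z \<in> \<phi> -` S \<inter> UNIV"
  have "\<exists>V. open V \<and> z \<in> V \<and> (\<forall>U. open U \<and> 0 \<in> U \<longrightarrow>
      (\<exists>W. open W \<and> 0 \<in> W \<and> (\<forall>x\<in>V. \<forall>y\<in>V. - x + y \<in> W \<longrightarrow> \<phi> x - \<phi> y \<in> U)))"
    using assms(3) unfolding LUC_loc_def mem_Collect_eq by (rule spec)
  then obtain V where V: "open V" "z \<in> V" and uniform: "\<forall>U. open U \<and> 0 \<in> U \<longrightarrow>
      (\<exists>W. open W \<and> 0 \<in> W \<and> (\<forall>x\<in>V. \<forall>y\<in>V. - x + y \<in> W \<longrightarrow> \<phi> x - \<phi> y \<in> U))"
    by blast
  define U where "U = {u. \<phi> z + (- 1) *\<^sub>R u \<in> S}"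
  have "open U" unfolding U_def by (rule locally_convex_open_affine_vimage[OF lc S])
  moreover have "0 \<in> U" using z by (simp add: U_def)
  ultimately obtain W where W: "open W" "0 \<in> W" "\<forall>x\<in>V. \<forall>y\<in>V. - x + y \<in> W \<longrightarrow> \<phi> x - \<phi> y \<in> U"
    using uniform by blast
  show "\<exists>T. open T \<and> z \<in> T \<and> T \<subseteq> \<phi> -` S \<inter> UNIV"
  proof (intro exI conjI)
    show "open (V \<inter> {y. - z + y \<in> W})"
      using V(1) topological_group_open_left_translate[OF tg W(1)] by (rule open_Int)
    show "z \<in> V \<inter> {y. - z + y \<in> W}" using V(2) W(2) by simp
    show "V \<inter> {y. - z + y \<in> W} \<subseteq> \<phi> -` S \<inter> UNIV"
    proof
      fix y assume "y \<in> V \<inter> {y. - z + y \<in> W}"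
      then have "\<phi> z - \<phi> y \<in> U" using W(3) V(2) by blast
      then show "y \<in> \<phi> -` S \<inter> UNIV" by (simp add: U_def)
    qed
  qed
qed

lemma tendsto_LUC_loc_left_translate:
  fixes \<phi> :: "'g::{t2_space,group_add} \<Rightarrow> 'y::{t2_space,real_vector}"
  assumes tg: "topological_group TYPE('g)" and lc: "locally_convex_space TYPE('y)"
    and "\<phi> \<in> LUC_loc" "(f \<longlongrightarrow> a) F"
  shows "((\<lambda>x. \<phi> (g + f x)) \<longlongrightarrow> \<phi> (g + a)) F"
proof -
  have "continuous_on UNIV \<phi>" by (rule LUC_loc_continuous[OF tg lc assms(3)])
  moreover have "continuous_on UNIV (\<lambda>x. g + x)"
    by (rule topological_group_continuous_on_add[OF tg continuous_on_const continuous_on_id])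
  ultimately have "continuous_on UNIV (\<lambda>x. \<phi> (g + x))"
    by (rule continuous_on_compose2) auto
  then show ?thesis using assms(4) by (rule continuous_on_tendsto_compose) auto
qed

lemma LUC1_loc_has_left_deriv:
  assumes "\<phi> \<in> LUC1_loc" "Y \<in> one_param_subgroups"
  shows "has_left_deriv \<phi> Y p (left_deriv \<phi> Y p)"
proof -
  obtain d where "has_left_deriv \<phi> Y p d" using assms unfolding LUC1_loc_def by blast
  then show ?thesis unfolding has_left_deriv_def left_deriv_def
    by (simp add: tendsto_Lim)
qed

lemma LUC1_loc_continuous_left_deriv:
  fixes \<phi> :: "'g::{t2_space,group_add} \<Rightarrow> 'y::{t2_space,real_vector}"
  assumes "topological_group TYPE('g)" "locally_convex_space TYPE('y)"
    and "\<phi> \<in> LUC1_loc" "Y \<in> one_param_subgroups"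
  shows "continuous_on UNIV (left_deriv \<phi> Y)"
  using assms by (intro LUC_loc_continuous) (auto simp: LUC1_loc_def)

lemma has_left_deriv_increment:
  assumes "locally_convex_space TYPE('y::{t2_space,real_vector})"
    and "has_left_deriv (\<phi> :: 'g::{topological_space,group_add} \<Rightarrow> 'y) X g d" "open C" "0 \<in> C"
  shows "\<forall>\<^sub>F t in at_right 0. \<phi> (g + X t) - \<phi> g - t *\<^sub>R d \<in> (*\<^sub>R) t ` C"
proof -
  have "\<forall>\<^sub>F t in at 0. (1 / t) *\<^sub>R (\<phi> (g + X t) - \<phi> g) - d \<in> C"
    using assms unfolding has_left_deriv_def by (intro tendsto_eventually_diff_mem) auto
  then have "\<forall>\<^sub>F t in at_right 0. (1 / t) *\<^sub>R (\<phi> (g + X t) - \<phi> g) - d \<in> C"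
    by (simp add: eventually_at_split)
  then show ?thesis using eventually_at_right_less[of 0]
  proof (rule eventually_elim2)
    fix t :: real assume "(1 / t) *\<^sub>R (\<phi> (g + X t) - \<phi> g) - d \<in> C" "0 < t"
    then show "\<phi> (g + X t) - \<phi> g - t *\<^sub>R d \<in> (*\<^sub>R) t ` C"
      by (intro image_eqI[of _ _ "(1 / t) *\<^sub>R (\<phi> (g + X t) - \<phi> g) - d"])
        (auto simp: scaleR_diff_right)
  qed
qed

lemma uniform_increment_estimate:
  fixes \<phi> :: "'g::{t2_space,group_add} \<Rightarrow> 'y::{t2_space,real_vector}"
  assumes tg: "topological_group TYPE('g)" and lc: "locally_convex_space TYPE('y)"
    and Y: "Y \<in> one_param_subgroups"
    and deriv: "\<And>p. has_left_deriv \<phi> Y p (D p)" and D: "continuous_on UNIV D"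
    and C: "convex C" "open C" "0 \<in> C"
  obtains V where "open V" "g \<in> V"
    "\<forall>\<^sub>F s in at_right 0. \<forall>p\<in>V. \<phi> (p + Y s) - \<phi> p - s *\<^sub>R D g \<in> (*\<^sub>R) s ` C"
proof -
  have "open {q. D q - D g \<in> C}"
    using open_vimage_continuous_UNIV[OF D locally_convex_open_diff_vimage[OF lc C(2)]] by simp
  then obtain V W where VW: "open V" "open W" "g \<in> V" "0 \<in> W"
      "\<And>p w. p \<in> V \<Longrightarrow> w \<in> W \<Longrightarrow> D (p + w) - D g \<in> C"
    by (rule topological_group_open_sum_nhds[OF tg, of "{q. D q - D g \<in> C}" g 0]) (use C(3) in auto)
  obtain \<delta> where \<delta>: "\<delta> > 0" "\<And>r. \<bar>r\<bar> < \<delta> \<Longrightarrow> Y r \<in> W"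
    using one_param_subgroup_small[OF Y VW(2,4)] by blast
  have "\<phi> (p + Y s) - \<phi> p - s *\<^sub>R D g \<in> (*\<^sub>R) s ` C" if p: "p \<in> V" and s: "0 < s" "s < \<delta>" for p s
  proof -
    define f where "f r = \<phi> (p + Y r) - r *\<^sub>R D g" for r
    have "f s - f 0 \<in> (*\<^sub>R) s ` C"
    proof (rule mean_value_convex[OF C(1,3)])
      fix r assume r: "0 \<le> r" "r \<le> s"
      define q where "q = p + Y r"
      have "D q - D g \<in> C" unfolding q_def using VW(5) p \<delta>(2) r s by auto
      then have "\<forall>\<^sub>F h in at 0. (1 / h) *\<^sub>R (\<phi> (q + Y h) - \<phi> q) - D g \<in> C"
        using deriv[of q] C(2) unfolding has_left_deriv_def
        by (intro tendsto_eventually_diff_mem[OF lc]) auto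
      moreover have "(1 / h) *\<^sub>R (f (r + h) - f r) = (1 / h) *\<^sub>R (\<phi> (q + Y h) - \<phi> q) - D g"
        if "h \<noteq> 0" for h
        using that unfolding f_def q_def one_param_subgroup_add[OF Y]
        by (simp add: algebra_simps)
      ultimately show "\<forall>\<^sub>F h in at 0. (1 / h) *\<^sub>R (f (r + h) - f r) \<in> C"
        by (auto simp: eventually_at_filter elim: eventually_mono)
    qed (use s in auto)
    moreover have "f s - f 0 = \<phi> (p + Y s) - \<phi> p - s *\<^sub>R D g"
      unfolding f_def by (simp add: one_param_subgroup_zero[OF Y] algebra_simps)
    ultimately show ?thesis by simp
  qed
  with \<delta>(1) have "\<forall>\<^sub>F s in at_right 0. \<forall>p\<in>V. \<phi> (p + Y s) - \<phi> p - s *\<^sub>R D g \<in> (*\<^sub>R) s ` C"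
    unfolding eventually_at_right_field by blast
  with VW(1,3) show ?thesis by (rule that)
qed

lemma product_increment_estimate:
  fixes \<phi> :: "'g::{t2_space,group_add} \<Rightarrow> 'y::{t2_space,real_vector}"
  assumes tg: "topological_group TYPE('g)" and lc: "locally_convex_space TYPE('y)"
    and X1: "X1 \<in> one_param_subgroups" and X2: "X2 \<in> one_param_subgroups"
    and "\<And>p. has_left_deriv \<phi> X1 p (D1 p)" "continuous_on UNIV D1"
    and "\<And>p. has_left_deriv \<phi> X2 p (D2 p)" "continuous_on UNIV D2"
    and C: "convex C" "open C" "0 \<in> C"
  obtains V where "open V" "g \<in> V"
    "\<forall>\<^sub>F s in at_right 0. \<forall>p\<in>V.
       \<phi> (p + (X1 s + X2 s)) - \<phi> p - s *\<^sub>R (D1 g + D2 g) \<in> (*\<^sub>R) (2 * s) ` C"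
proof -
  obtain V1 where V1: "open V1" "g \<in> V1"
      "\<forall>\<^sub>F s in at_right 0. \<forall>p\<in>V1. \<phi> (p + X1 s) - \<phi> p - s *\<^sub>R D1 g \<in> (*\<^sub>R) s ` C"
    using uniform_increment_estimate[OF tg lc X1 assms(5,6) C] by blast
  obtain V2 where V2: "open V2" "g \<in> V2"
      "\<forall>\<^sub>F s in at_right 0. \<forall>p\<in>V2. \<phi> (p + X2 s) - \<phi> p - s *\<^sub>R D2 g \<in> (*\<^sub>R) s ` C"
    using uniform_increment_estimate[OF tg lc X2 assms(7,8) C] by blast
  obtain V W where VW: "open V" "open W" "g \<in> V" "0 \<in> W" "\<And>p w. p \<in> V \<Longrightarrow> w \<in> W \<Longrightarrow> p + w \<in> V2"
    by (rule topological_group_open_sum_nhds[OF tg V2(1), of g 0]) (use V2(2) in auto)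
  obtain \<delta> where "\<delta> > 0" "\<And>r. \<bar>r\<bar> < \<delta> \<Longrightarrow> X1 r \<in> W"
    using one_param_subgroup_small[OF X1 VW(2,4)] by blast
  then have "\<forall>\<^sub>F s in at_right 0. X1 s \<in> W"
    unfolding eventually_at_right_field by (auto intro!: exI[of _ \<delta>])
  with V1(3) V2(3) eventually_at_right_less[of 0] have "\<forall>\<^sub>F s in at_right 0. \<forall>p\<in>V1 \<inter> V.
      \<phi> (p + (X1 s + X2 s)) - \<phi> p - s *\<^sub>R (D1 g + D2 g) \<in> (*\<^sub>R) (2 * s) ` C"
  proof (eventually_elim, intro ballI)
    fix s p
    assume est1: "\<forall>p\<in>V1. \<phi> (p + X1 s) - \<phi> p - s *\<^sub>R D1 g \<in> (*\<^sub>R) s ` C"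
      and est2: "\<forall>p\<in>V2. \<phi> (p + X2 s) - \<phi> p - s *\<^sub>R D2 g \<in> (*\<^sub>R) s ` C"
      and "0 < s" "X1 s \<in> W" and p: "p \<in> V1 \<inter> V"
    then have "p + X1 s \<in> V2" using VW(5) by blast
    then have "(\<phi> (p + X1 s + X2 s) - \<phi> (p + X1 s) - s *\<^sub>R D2 g)
        + (\<phi> (p + X1 s) - \<phi> p - s *\<^sub>R D1 g) \<in> (*\<^sub>R) (s + s) ` C"
      using est1 est2 p C(1,3) \<open>0 < s\<close> by (intro scaled_convex_add) auto
    then show "\<phi> (p + (X1 s + X2 s)) - \<phi> p - s *\<^sub>R (D1 g + D2 g) \<in> (*\<^sub>R) (2 * s) ` C"
      by (simp add: algebra_simps)
  qed
  with V1(1,2) VW(1,3) show ?thesis by (intro that[of "V1 \<inter> V"]) auto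
qed

(* uniform convergence on compact sets with respect to the left uniformity of the group *)
definition compactly_tendsto ::
  "(nat \<Rightarrow> real \<Rightarrow> 'g::{topological_space,group_add}) \<Rightarrow> (real \<Rightarrow> 'g) \<Rightarrow> bool" where
  "compactly_tendsto F X \<longleftrightarrow> (\<forall>K U. compact K \<longrightarrow> open U \<longrightarrow> 0 \<in> U \<longrightarrow>
     (\<forall>\<^sub>F n in sequentially. \<forall>t\<in>K. - X t + F n t \<in> U))"

lemma compactly_tendstoD:
  "compactly_tendsto F X \<Longrightarrow> compact K \<Longrightarrow> open U \<Longrightarrow> 0 \<in> U \<Longrightarrow>
    \<forall>\<^sub>F n in sequentially. \<forall>t\<in>K. - X t + F n t \<in> U"
  by (simp add: compactly_tendsto_def)

lemma compactly_tendsto_pointwise: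
  assumes "topological_group TYPE('g::{t2_space,group_add})" "compactly_tendsto F (X :: real \<Rightarrow> 'g)"
  shows "((\<lambda>n. F n t) \<longlongrightarrow> X t) sequentially"
  using compactly_tendstoD[OF assms(2) compact_sing]
  by (intro tendsto_group_left_difference[OF assms(1)]) auto

lemma tendsto_gpow_product_zero:
  assumes tg: "topological_group TYPE('g::{t2_space,group_add})"
    and X1: "X1 \<in> one_param_subgroups" and X2: "(X2 :: real \<Rightarrow> 'g) \<in> one_param_subgroups"
  shows "((\<lambda>n. gpow k (X1 (t / real n) + X2 (t / real n))) \<longlongrightarrow> 0) sequentially"
proof -
  have "continuous_on UNIV (\<lambda>r. X1 r + X2 r)"
    using X1 X2 by (intro topological_group_continuous_on_add[OF tg] one_param_subgroup_continuous)
  then have "continuous_on UNIV (\<lambda>r. gpow k (X1 r + X2 r))"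
    by (rule continuous_on_compose2[OF continuous_on_gpow[OF tg]]) auto
  from continuous_on_tendsto_compose[OF this lim_const_over_n[of t]] show ?thesis
    by (simp add: one_param_subgroup_zero[OF X1] one_param_subgroup_zero[OF X2] gpow_zero_right)
qed

lemma trotter_partial_products_small:
  fixes X X1 X2 :: "real \<Rightarrow> 'g::{t2_space,group_add}"
  assumes tg: "topological_group TYPE('g)"
    and X: "X \<in> one_param_subgroups" and X1: "X1 \<in> one_param_subgroups" and X2: "X2 \<in> one_param_subgroups"
    and lim: "compactly_tendsto (\<lambda>n t. gpow n (X1 (t / real n) + X2 (t / real n))) X"
    and V: "open V" "0 \<in> V"
  shows "\<forall>\<^sub>F t in at_right 0. \<forall>\<^sub>F n in sequentially.
           \<forall>k<n. gpow k (X1 (t / real n) + X2 (t / real n)) \<in> V"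
proof -
  obtain A B where AB: "open A" "open B" "0 \<in> A" "0 \<in> B" "\<And>x y. x \<in> A \<Longrightarrow> y \<in> B \<Longrightarrow> x + y \<in> V"
    by (rule topological_group_open_sum_nhds[OF tg V(1), of 0 0]) (use V(2) in auto)
  obtain \<delta> where \<delta>: "\<delta> > 0" "\<And>r. \<bar>r\<bar> < \<delta> \<Longrightarrow> X r \<in> A"
    using one_param_subgroup_small[OF X AB(1,3)] by blast
  have "\<forall>\<^sub>F n in sequentially. \<forall>k<n. gpow k (X1 (t / real n) + X2 (t / real n)) \<in> V"
    if t: "0 < t" "t < \<delta>" for t
  proof -
    obtain N where N: "\<And>m t'. N \<le> m \<Longrightarrow> t' \<in> {0..t} \<Longrightarrow>
        - X t' + gpow m (X1 (t' / real m) + X2 (t' / real m)) \<in> B"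
      using compactly_tendstoD[OF lim compact_Icc AB(2,4), of 0 t]
      unfolding eventually_sequentially by blast
    \<comment> \<open>the \<open>k\<close>-th partial product at \<open>t / n\<close> is the \<open>k\<close>-th approximant of \<open>X (t k / n)\<close>\<close>
    have large: "gpow k (X1 (t / real n) + X2 (t / real n)) \<in> V" if k: "N \<le> k" "k < n" "0 < k" for k n
    proof -
      define t' where "t' = t * real k / real n"
      have "t' \<in> {0..t}" "t' / real k = t / real n"
        using t k by (auto simp: t'_def field_simps)
      then have "- X t' + gpow k (X1 (t / real n) + X2 (t / real n)) \<in> B" using N[of k t'] k by simp
      moreover have "X t' \<in> A" using \<delta>(2) \<open>t' \<in> {0..t}\<close> t by auto
      ultimately have "X t' + (- X t' + gpow k (X1 (t / real n) + X2 (t / real n))) \<in> V"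
        by (rule AB(5)[rotated])
      then show ?thesis by (simp add: add.assoc[symmetric])
    qed
    have "\<forall>\<^sub>F n in sequentially. gpow k (X1 (t / real n) + X2 (t / real n)) \<in> V" for k
      using tendsto_gpow_product_zero[OF tg X1 X2] V by (rule topological_tendstoD)
    then have "\<forall>\<^sub>F n in sequentially. \<forall>k\<in>{..<N}. gpow k (X1 (t / real n) + X2 (t / real n)) \<in> V"
      by (intro eventually_ball_finite) auto
    then show ?thesis
      by (rule eventually_mono) (metis large V(2) gpow.simps(1) lessThan_iff not_le not_gr0)
  qed
  with \<delta>(1) show ?thesis unfolding eventually_at_right_field by blast
qed

lemma gpow_increment_estimate:
  fixes \<phi> :: "'g::group_add \<Rightarrow> 'y::real_vector"
  assumes "convex C" "0 \<in> C" "0 \<le> a" "\<forall>k<n. g + gpow k h \<in> V"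
    and "\<forall>p\<in>V. \<phi> (p + h) - \<phi> p - w \<in> (*\<^sub>R) a ` C"
  shows "\<phi> (g + gpow n h) - \<phi> g - real n *\<^sub>R w \<in> (*\<^sub>R) (real n * a) ` C"
  using scaled_convex_telescope[where f = "\<lambda>k. \<phi> (g + gpow k h)"] assms
  by (auto simp del: gpow.simps(2) simp add: gpow_Suc_right add.assoc[symmetric])

lemma trotter_increment_estimate:
  fixes \<phi> :: "'g::{t2_space,group_add} \<Rightarrow> 'y::{t2_space,real_vector}"
  assumes tg: "topological_group TYPE('g)" and lc: "locally_convex_space TYPE('y)"
    and X: "X \<in> one_param_subgroups" and X1: "X1 \<in> one_param_subgroups" and X2: "X2 \<in> one_param_subgroups"
    and lim: "compactly_tendsto (\<lambda>n t. gpow n (X1 (t / real n) + X2 (t / real n))) X"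
    and "\<And>p. has_left_deriv \<phi> X1 p (D1 p)" "continuous_on UNIV D1"
    and "\<And>p. has_left_deriv \<phi> X2 p (D2 p)" "continuous_on UNIV D2"
    and C: "convex C" "open C" "0 \<in> C"
  shows "\<forall>\<^sub>F t in at_right 0. \<forall>\<^sub>F n in sequentially.
           \<phi> (g + gpow n (X1 (t / real n) + X2 (t / real n))) - \<phi> g - t *\<^sub>R (D1 g + D2 g)
             \<in> (*\<^sub>R) (2 * t) ` C"
proof -
  obtain V where V: "open V" "g \<in> V" and step: "\<forall>\<^sub>F s in at_right 0. \<forall>p\<in>V.
      \<phi> (p + (X1 s + X2 s)) - \<phi> p - s *\<^sub>R (D1 g + D2 g) \<in> (*\<^sub>R) (2 * s) ` C"
    using product_increment_estimate[OF tg lc X1 X2 assms(7-10) C] by blast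
  have "\<forall>\<^sub>F t in at_right 0. \<forall>\<^sub>F n in sequentially.
      \<forall>k<n. gpow k (X1 (t / real n) + X2 (t / real n)) \<in> {w. g + w \<in> V}"
    using V by (intro trotter_partial_products_small[OF tg X X1 X2 lim]
        topological_group_open_left_translate[OF tg]) auto
  then show ?thesis using eventually_at_right_less[of 0]
  proof eventually_elim
    fix t :: real
    assume path: "\<forall>\<^sub>F n in sequentially.
        \<forall>k<n. gpow k (X1 (t / real n) + X2 (t / real n)) \<in> {w. g + w \<in> V}" and "0 < t"
    then have "filterlim (\<lambda>n. t / real n) (at_right 0) sequentially"
      by (intro tendsto_imp_filterlim_at_right lim_const_over_n)
        (auto intro: eventually_sequentiallyI[of 1])
    with step have "\<forall>\<^sub>F n in sequentially. \<forall>p\<in>V. \<phi> (p + (X1 (t / real n) + X2 (t / real n))) - \<phi> p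
        - (t / real n) *\<^sub>R (D1 g + D2 g) \<in> (*\<^sub>R) (2 * (t / real n)) ` C"
      by (rule eventually_compose_filterlim)
    with path eventually_gt_at_top[of 0]
    show "\<forall>\<^sub>F n in sequentially. \<phi> (g + gpow n (X1 (t / real n) + X2 (t / real n))) - \<phi> g
        - t *\<^sub>R (D1 g + D2 g) \<in> (*\<^sub>R) (2 * t) ` C"
    proof eventually_elim
      fix n :: nat
      assume "\<forall>k<n. gpow k (X1 (t / real n) + X2 (t / real n)) \<in> {w. g + w \<in> V}" "0 < n"
        and "\<forall>p\<in>V. \<phi> (p + (X1 (t / real n) + X2 (t / real n))) - \<phi> p
          - (t / real n) *\<^sub>R (D1 g + D2 g) \<in> (*\<^sub>R) (2 * (t / real n)) ` C"
      from gpow_increment_estimate[where n = n and g = g, OF C(1,3) _ _ this(3)] this(1,2) \<open>0 < t\<close>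
      show "\<phi> (g + gpow n (X1 (t / real n) + X2 (t / real n))) - \<phi> g - t *\<^sub>R (D1 g + D2 g)
          \<in> (*\<^sub>R) (2 * t) ` C"
        by simp
    qed
  qed
qed

lemma LUC1_loc_trotter_estimate:
  fixes \<phi> :: "'g::{t2_space,group_add} \<Rightarrow> 'y::{t2_space,real_vector}"
  assumes tg: "topological_group TYPE('g)" and lc: "locally_convex_space TYPE('y)"
    and X: "X \<in> one_param_subgroups" and X1: "X1 \<in> one_param_subgroups" and X2: "X2 \<in> one_param_subgroups"
    and lim: "compactly_tendsto (\<lambda>n t. gpow n (X1 (t / real n) + X2 (t / real n))) X"
    and \<phi>: "\<phi> \<in> LUC1_loc"
    and C: "convex C" "open C" "0 \<in> C" "\<And>c. c \<in> C \<Longrightarrow> - c \<in> C"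
  shows "left_deriv \<phi> X g - (left_deriv \<phi> X1 g + left_deriv \<phi> X2 g) \<in> (*\<^sub>R) 4 ` C"
proof -
  define d where "d = left_deriv \<phi> X g"
  define D where "D = left_deriv \<phi> X1 g + left_deriv \<phi> X2 g"
  define P where "P n t = gpow n (X1 (t / real n) + X2 (t / real n))" for n t
  have "\<forall>\<^sub>F t in at_right 0. (\<phi> (g + X t) - \<phi> g - t *\<^sub>R d \<in> (*\<^sub>R) t ` C)
      \<and> (\<forall>\<^sub>F n in sequentially. \<phi> (g + P n t) - \<phi> g - t *\<^sub>R D \<in> (*\<^sub>R) (2 * t) ` C) \<and> 0 < t"
    unfolding d_def D_def P_def
    using has_left_deriv_increment[OF lc LUC1_loc_has_left_deriv[OF \<phi> X] C(2,3)]
      trotter_increment_estimate[OF tg lc X X1 X2 lim LUC1_loc_has_left_deriv[OF \<phi> X1]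
        LUC1_loc_continuous_left_deriv[OF tg lc \<phi> X1] LUC1_loc_has_left_deriv[OF \<phi> X2]
        LUC1_loc_continuous_left_deriv[OF tg lc \<phi> X2] C(1-3)]
      eventually_at_right_less
    by (intro eventually_conj)
  from eventually_happens'[OF trivial_limit_at_right_real this]
  obtain t where t: "0 < t" and near_X: "\<phi> (g + X t) - \<phi> g - t *\<^sub>R d \<in> (*\<^sub>R) t ` C"
    and near_D: "\<forall>\<^sub>F n in sequentially. \<phi> (g + P n t) - \<phi> g - t *\<^sub>R D \<in> (*\<^sub>R) (2 * t) ` C"
    by blast
  have "((\<lambda>n. \<phi> (g + P n t)) \<longlongrightarrow> \<phi> (g + X t)) sequentially"
    using \<phi> compactly_tendsto_pointwise[OF tg lim] unfolding P_def LUC1_loc_def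
    by (intro tendsto_LUC_loc_left_translate[OF tg lc]) auto
  then have "\<forall>\<^sub>F n in sequentially. \<phi> (g + P n t) - \<phi> (g + X t) \<in> (*\<^sub>R) t ` C"
    using t C(2,3) by (intro tendsto_eventually_diff_mem[OF lc] locally_convex_open_scaled[OF lc]) auto
  from eventually_happens'[OF sequentially_bot eventually_conj[OF this near_D]]
  obtain n where near_P: "\<phi> (g + P n t) - \<phi> (g + X t) \<in> (*\<^sub>R) t ` C"
    and "\<phi> (g + P n t) - \<phi> g - t *\<^sub>R D \<in> (*\<^sub>R) (2 * t) ` C"
    by blast
  \<comment> \<open>\<open>t (d - D)\<close> is the sum of the three estimated differences, two of them negated\<close>
  then have "(- (\<phi> (g + X t) - \<phi> g - t *\<^sub>R d) + - (\<phi> (g + P n t) - \<phi> (g + X t)))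
      + (\<phi> (g + P n t) - \<phi> g - t *\<^sub>R D) \<in> (*\<^sub>R) ((t + t) + 2 * t) ` C"
    using C t scaled_symmetric_uminus[OF C(4) near_X] scaled_symmetric_uminus[OF C(4) near_P]
    by (intro scaled_convex_add) auto
  then obtain c where c: "c \<in> C" "t *\<^sub>R (d - D) = t *\<^sub>R (4 *\<^sub>R c)"
    by (auto simp: algebra_simps)
  then have "d - D = 4 *\<^sub>R c" using t by (simp only: scaleR_cancel_left) simp
  with c(1) show ?thesis unfolding d_def D_def by blast
qed

theorem lemma2p3:
  fixes X X1 X2 :: "real \<Rightarrow> 'g::{t2_space,group_add}"
  assumes "topological_group TYPE('g)"
    and "locally_convex_space TYPE('y::{t2_space,real_vector})"
    and "X \<in> one_param_subgroups" "X1 \<in> one_param_subgroups" "X2 \<in> one_param_subgroups"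
    and "\<And>K U. compact K \<Longrightarrow> open U \<Longrightarrow> 0 \<in> U \<Longrightarrow>
           eventually (\<lambda>n. \<forall>t\<in>K. - X t + gpow n (X1 (t / real n) + X2 (t / real n)) \<in> U) sequentially"
  shows "\<forall>\<phi>::'g \<Rightarrow> 'y. \<phi> \<in> LUC1_loc \<longrightarrow>
           left_deriv \<phi> X = (\<lambda>g. left_deriv \<phi> X1 g + left_deriv \<phi> X2 g)"
proof (intro allI impI ext)
  fix \<phi> :: "'g \<Rightarrow> 'y" and g :: 'g
  assume \<phi>: "\<phi> \<in> LUC1_loc"
  have lim: "compactly_tendsto (\<lambda>n t. gpow n (X1 (t / real n) + X2 (t / real n))) X"
    using assms(6) by (simp add: compactly_tendsto_def)
  show "left_deriv \<phi> X g = left_deriv \<phi> X1 g + left_deriv \<phi> X2 g"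
  proof (rule ccontr)
    assume "left_deriv \<phi> X g \<noteq> left_deriv \<phi> X1 g + left_deriv \<phi> X2 g"
    then obtain C where "convex C" "open C" "0 \<in> C" "\<And>c. c \<in> C \<Longrightarrow> - c \<in> C"
      and "left_deriv \<phi> X g - (left_deriv \<phi> X1 g + left_deriv \<phi> X2 g) \<notin> (*\<^sub>R) 4 ` C"
      using locally_convex_symmetric_nhd_avoiding[OF assms(2), of _ 4] by (metis right_minus_eq zero_less_numeral)
    with LUC1_loc_trotter_estimate[OF assms(1-5) lim \<phi>] show False by blast
  qed
qed

end
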